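(* Let $q$ be a complex number with $|q|<1$. Then the following two identities hold: \begin{align*} \sum_{i,j,k\ge 0}\frac{q^{\frac{1}{2}i^2+j^2+4k^2+ij+2jk+\frac{1}{2}i+j}}{(q;q)_i(q;q)_j(q^2;q^2)_k} &= \frac{(q^8,q^{12},q^{20};q^{20})_\infty}{(q;q)_\infty},\\ \sum_{i,j,k\ge 0}\frac{q^{\frac{1}{2}i^2+j^2+4k^2+ij+2jk+\frac{1}{2}i+j+4k}}{(q;q)_i(q;q)_j(q^2;q^2)_k} &=\frac{(q^4,q^{16},q^{20};q^{20})_\infty}{(q;q)_\infty}. \end{align*}
   Context: For $|q|<1$: $(a;q)_\infty=\prod_{m=0}^\infty(1-aq^m)$, $(a;q)_n=(a;q)_\infty/(aq^n;q)_\infty=\prod_{m=0}^{n-1}(1-aq^m)$ for integers $n\ge0$, and $(a_1,\dots,a_r;q)_\infty=(a_1;q)_\infty\cdots(a_r;q)_\infty$; the same notation is used with the base $q$ replaced by a power of $q$. All exponents of $q$ in the sums are integers. *)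

theory Defs
  imports "HOL-Analysis.Analysis"
begin

definition qpoch :: "complex \<Rightarrow> complex \<Rightarrow> nat \<Rightarrow> complex" where
  "qpoch a q n = (\<Prod>m<n. 1 - a * q ^ m)"

(* (a;q)_infinity; meaningful for norm q < 1, where the product converges
   (see has_prod_qpoch_inf, which allows factors that vanish). *)
definition qpoch_inf :: "complex \<Rightarrow> complex \<Rightarrow> complex" where
  "qpoch_inf a q = (\<Prod>m. 1 - a * q ^ m)"

(* (a_1,...,a_r;q)_infinity *)
definition qpoch_inf_list :: "complex list \<Rightarrow> complex \<Rightarrow> complex" where
  "qpoch_inf_list as q = (\<Prod>a\<leftarrow>as. qpoch_inf a q)"

lemma has_prod_qpoch_inf:
  assumes "norm q < 1"
  shows "(\<lambda>m. 1 - a * q ^ m) has_prod qpoch_inf a q"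
proof -
  have "summable (\<lambda>m. norm a * norm q ^ m)"
    using assms by (intro summable_mult summable_geometric) auto
  then have "summable (\<lambda>m. norm ((1 - a * q ^ m) - 1))"
    by (simp add: norm_mult norm_power)
  then have "abs_convergent_prod (\<lambda>m. 1 - a * q ^ m)"
    by (rule summable_imp_abs_convergent_prod)
  then have "convergent_prod (\<lambda>m. 1 - a * q ^ m)"
    by (rule abs_convergent_prod_imp_convergent_prod)
  then show ?thesis
    unfolding qpoch_inf_def by (rule convergent_prod_has_prod)
qed

(* The agreement with the quotient (a;q)_infinity / (a q^n;q)_infinity
   requires that the denominator does not vanish. *)
lemma qpoch_eq_quotient:
  assumes "norm q < 1" "qpoch_inf (a * q ^ n) q \<noteq> 0"
  shows "qpoch a q n = qpoch_inf a q / qpoch_inf (a * q ^ n) q"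
proof -
  have "(\<lambda>m. 1 - a * q ^ n * q ^ m) has_prod qpoch_inf (a * q ^ n) q"
    using assms(1) by (rule has_prod_qpoch_inf)
  then have "(\<lambda>m. \<Prod>i\<le>m. 1 - a * q ^ n * q ^ i) \<longlonglongrightarrow> qpoch_inf (a * q ^ n) q"
    by (metis convergent_prod_LIMSEQ has_prod_iff)
  then have "(\<lambda>m. qpoch a q n * (\<Prod>i\<le>m. 1 - a * q ^ n * q ^ i))
      \<longlonglongrightarrow> qpoch a q n * qpoch_inf (a * q ^ n) q"
    by (intro tendsto_mult tendsto_const)
  moreover have "qpoch a q n * (\<Prod>i\<le>m. 1 - a * q ^ n * q ^ i)
      = (\<Prod>i\<le>m + n. 1 - a * q ^ i)" for m
    unfolding qpoch_def
    by (induction m) (auto simp: power_add mult_ac lessThan_Suc_atMost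
        simp flip: lessThan_Suc_atMost)
  moreover have "(\<lambda>m. \<Prod>i\<le>m + n. 1 - a * q ^ i) \<longlonglongrightarrow> qpoch_inf a q"
    using has_prod_qpoch_inf[OF assms(1), of a]
    by (intro LIMSEQ_ignore_initial_segment) (metis convergent_prod_LIMSEQ has_prod_iff)
  ultimately have "qpoch a q n * qpoch_inf (a * q ^ n) q = qpoch_inf a q"
    using LIMSEQ_unique by simp
  with assms(2) show ?thesis
    by (simp add: field_simps)
qed

end

theory Submission
  imports Defs
begin

text \<open>
  The triple sum collapses to a single sum because two of its variables occur in Euler's
  expansion \<open>\<Sum>n. x^n q^(n choose 2) / (q;q)_n = (-x;q)_\<infinity>\<close>.  Summing over \<open>i\<close> produces
  \<open>(-q^(j+1);q)_\<infinity>\<close>, which divided by \<open>(q;q)_j\<close> is \<open>(-q;q)_\<infinity> / (q^2;q^2)_j\<close>.  What remains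
  of the \<open>j\<close>-sum is again of Euler's form, now in base \<open>q^2\<close>, and the same quotient rule turns
  the denominator \<open>(q^2;q^2)_k\<close> into \<open>(q^4;q^4)_k\<close>.  The \<open>k\<close>-sum left over is a
  Rogers-Ramanujan sum in base \<open>q^4\<close>, multiplied by
  \<open>(-q;q)_\<infinity> (-q^2;q^2)_\<infinity> = (q^4;q^4)_\<infinity> / (q;q)_\<infinity>\<close>; this is \<open>triple_sum_eq_rr_sum\<close>.  Absolute
  convergence, from comparison with a triple geometric series, allows the variables to be
  summed in this order.

  The two Rogers-Ramanujan identities are proved along the lines of Rogers and Ramanujan, as
  presented by Hardy and Wright.  The sums \<open>S n = (\<Sum>k. q^(k^2 + n k) / (q;q)_k)\<close> satisfy
  \<open>S n = S (n+1) + q^(n+1) S (n+2)\<close> and tend to 1.  A family of alternating series with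
  quadratic exponents, \<open>theta_sum\<close>, satisfies the same recurrence and tends to \<open>(q;q)_\<infinity>\<close>.
  The recurrence has no nonzero solution tending to 0
  (\<open>null_sequence_of_recurrence_eq_0\<close>), so the two families agree up to the factor
  \<open>(q;q)_\<infinity>\<close>.  For \<open>n = 0\<close>, and for \<open>n = 1\<close> in the form given by \<open>theta_sum_Suc\<close>, the
  alternating series is a theta series that Jacobi's triple product evaluates.

  Euler's expansion and Jacobi's triple product are both limits of the finite
  \<open>q\<close>-binomial theorem, taken under the sum by dominated convergence.
\<close>

section \<open>The q-Pochhammer symbol\<close>

lemma qpoch_0 [simp]: "qpoch a q 0 = 1"
  by (simp add: qpoch_def)

lemma qpoch_Suc: "qpoch a q (Suc n) = qpoch a q n * (1 - a * q ^ n)"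
  by (simp add: qpoch_def)

lemma qpoch_self_Suc: "qpoch q q (Suc n) = qpoch q q n * (1 - q ^ Suc n)"
  by (simp add: qpoch_Suc)

lemma one_minus_power_Suc_nonzero:
  fixes q :: complex
  assumes "norm q < 1"
  shows "1 - q ^ Suc n \<noteq> 0"
proof
  assume "1 - q ^ Suc n = 0"
  then have "norm q ^ Suc n = 1"
    by (metis eq_iff_diff_eq_0 norm_one norm_power)
  moreover have "norm q ^ Suc n < 1"
    using assms by (simp add: power_less_one_iff del: power_Suc)
  ultimately show False by simp
qed

lemma qpoch_self_nonzero:
  assumes "norm q < 1"
  shows "qpoch q q n \<noteq> 0"
  using one_minus_power_Suc_nonzero[OF assms] by (induction n) (auto simp: qpoch_self_Suc)

lemma qpoch_tendsto:
  assumes "norm q < 1"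
  shows "qpoch a q \<longlonglongrightarrow> qpoch_inf a q"
  using has_prod_imp_tendsto'[OF has_prod_qpoch_inf[OF assms, of a]]
  by (simp add: qpoch_def[abs_def])

lemma qpoch_inf_self_nonzero:
  assumes "norm q < 1"
  shows "qpoch_inf q q \<noteq> 0"
  using has_prod_eq_0_iff[OF has_prod_qpoch_inf[OF assms, of q]]
    one_minus_power_Suc_nonzero[OF assms] by auto

lemma qpoch_bounded:
  assumes "norm q < 1"
  obtains K where "K > 0" "\<And>n. norm (qpoch a q n) \<le> K"
  using qpoch_tendsto[OF assms, of a] convergent_imp_Bseq[of "qpoch a q"]
  by (auto simp: convergent_def Bseq_def)

lemma inverse_qpoch_self_bounded:
  assumes "norm q < 1"
  obtains K where "K > 0" "\<And>n. norm (inverse (qpoch q q n)) \<le> K"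
proof -
  have "(\<lambda>n. inverse (qpoch q q n)) \<longlonglongrightarrow> inverse (qpoch_inf q q)"
    using assms by (intro tendsto_inverse qpoch_tendsto qpoch_inf_self_nonzero)
  then have "Bseq (\<lambda>n. inverse (qpoch q q n))"
    by (intro convergent_imp_Bseq) (auto simp: convergent_def)
  then show ?thesis
    using that by (auto simp: Bseq_def)
qed

lemma qpoch_mult_qpoch_minus:
  "qpoch a q n * qpoch (- a) q n = qpoch (a\<^sup>2) (q\<^sup>2) n"
  by (induction n) (auto simp: qpoch_Suc algebra_simps power2_eq_square power_mult_distrib)

lemma norm_power_less_one:
  fixes q :: complex
  assumes "norm q < 1" "n > 0"
  shows "norm (q ^ n) < 1"
  using assms by (simp add: norm_power power_less_one_iff)

lemma qpoch_inf_mult_qpoch_inf_minus: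
  assumes "norm q < 1"
  shows "qpoch_inf a q * qpoch_inf (- a) q = qpoch_inf (a\<^sup>2) (q\<^sup>2)"
proof (rule LIMSEQ_unique)
  show "(\<lambda>n. qpoch a q n * qpoch (- a) q n) \<longlonglongrightarrow> qpoch_inf a q * qpoch_inf (- a) q"
    using assms by (intro tendsto_mult qpoch_tendsto)
  show "(\<lambda>n. qpoch a q n * qpoch (- a) q n) \<longlonglongrightarrow> qpoch_inf (a\<^sup>2) (q\<^sup>2)"
    using norm_power_less_one[OF assms, of 2]
    by (simp add: qpoch_mult_qpoch_minus qpoch_tendsto)
qed

lemma qpoch_add: "qpoch a q (m + n) = qpoch a q m * qpoch (a * q ^ m) q n"
  by (induction n) (auto simp: qpoch_Suc power_add mult_ac)

text \<open>
  The case \<open>a = - q\<close> rewrites the tails \<open>(-q^(j+1);q)_\<infinity>\<close> that Euler's expansion produces in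
  terms of one fixed infinite product.
\<close>

lemma qpoch_inf_split:
  assumes "norm q < 1"
  shows "qpoch_inf a q = qpoch a q m * qpoch_inf (a * q ^ m) q"
proof (rule LIMSEQ_unique)
  show "(\<lambda>n. qpoch a q (m + n)) \<longlonglongrightarrow> qpoch_inf a q"
    using LIMSEQ_ignore_initial_segment[OF qpoch_tendsto[OF assms, of a], of m]
    by (simp add: add.commute)
  show "(\<lambda>n. qpoch a q (m + n)) \<longlonglongrightarrow> qpoch a q m * qpoch_inf (a * q ^ m) q"
    unfolding qpoch_add using assms by (intro tendsto_mult tendsto_const qpoch_tendsto)
qed

section \<open>Quadratic exponents\<close>

lemma Suc_choose_two: "Suc n choose 2 = (n choose 2) + n"
  by (simp add: numeral_2_eq_2)

text \<open>
  All quadratic exponents are expressed through \<open>n choose 2\<close>.  This rule makes exponent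
  identities linear in the binomials, and avoids division by two.
\<close>

lemma add_choose_two: "(m + n) choose 2 = (m choose 2) + (n choose 2) + m * n"
  by (induction n) (auto simp: Suc_choose_two)

lemma twice_choose_two: "2 * (n choose 2) + n = n\<^sup>2"
  by (induction n) (auto simp: Suc_choose_two power2_eq_square)

lemma summable_power_choose_two:
  fixes q x :: complex
  assumes "norm q < 1"
  shows "summable (\<lambda>n. norm (x ^ n * q ^ (n choose 2)))"
proof -
  have "(\<lambda>n. norm x * norm q ^ n) \<longlonglongrightarrow> norm x * 0"
    using assms by (intro tendsto_mult tendsto_const LIMSEQ_power_zero) auto
  then have "eventually (\<lambda>n. norm x * norm q ^ n < 1 / 2) sequentially"
    by (rule order_tendstoD) simp
  then obtain N where N: "norm x * norm q ^ n \<le> 1 / 2" if "n \<ge> N" for n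
    by (auto simp: eventually_at_top_linorder intro: less_imp_le)
  show ?thesis
  proof (rule summable_ratio_test)
    fix n assume "n \<ge> N"
    have "norm (norm (x ^ Suc n * q ^ (Suc n choose 2)))
        = (norm x * norm q ^ n) * norm (x ^ n * q ^ (n choose 2))"
      by (simp add: Suc_choose_two norm_mult norm_power power_add)
    also have "\<dots> \<le> 1 / 2 * norm (x ^ n * q ^ (n choose 2))"
      using N[OF \<open>n \<ge> N\<close>] by (intro mult_right_mono) auto
    finally show "norm (norm (x ^ Suc n * q ^ (Suc n choose 2)))
        \<le> 1 / 2 * norm (norm (x ^ n * q ^ (n choose 2)))" by simp
  qed simp
qed

section \<open>The q-binomial theorem and Euler's expansion\<close>

text \<open>
  The Gaussian binomial coefficients.  One of the two \<open>q\<close>-Pascal rules serves as the definition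
  because coefficients outside the triangle then vanish, as the inductive proof of the
  \<open>q\<close>-binomial theorem requires; the quotient formula is \<open>qbinom_eq\<close>.
\<close>

fun qbinom :: "complex \<Rightarrow> nat \<Rightarrow> nat \<Rightarrow> complex" where
  "qbinom q n 0 = 1"
| "qbinom q 0 (Suc k) = 0"
| "qbinom q (Suc n) (Suc k) = qbinom q n (Suc k) + q ^ (n - k) * qbinom q n k"

lemma qbinom_eq_0: "n < k \<Longrightarrow> qbinom q n k = 0"
  by (induction q n k rule: qbinom.induct) auto

lemma qbinom_mult_qpoch:
  "qbinom q (m + k) k * (qpoch q q k * qpoch q q m) = qpoch q q (m + k)"
proof (induction "m + k" arbitrary: m k)
  case 0
  then show ?case by simp
next
  case (Suc N)
  show ?case
  proof (cases k)
    case 0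
    then show ?thesis by simp
  next
    case k: (Suc l)
    have N: "N = m + l" using Suc.hyps(2) k by simp
    have right: "qbinom q N l * (qpoch q q l * qpoch q q m) = qpoch q q N"
      using Suc.hyps(1)[of m l] N by simp
    have left: "qbinom q N (Suc l) * (qpoch q q (Suc l) * qpoch q q m)
        = qpoch q q N * (1 - q ^ m)"
    proof (cases m)
      case 0
      then show ?thesis using N by (simp add: qbinom_eq_0)
    next
      case (Suc m')
      then have "qbinom q N (Suc l) * (qpoch q q (Suc l) * qpoch q q m') = qpoch q q N"
        using Suc.hyps(1)[of m' "Suc l"] N by simp
      then show ?thesis
        unfolding Suc qpoch_self_Suc[of q m'] by (simp add: mult_ac)
    qed
    have "qbinom q (m + k) k * (qpoch q q k * qpoch q q m)
        = qbinom q N (Suc l) * (qpoch q q (Suc l) * qpoch q q m)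
          + q ^ m * (1 - q ^ Suc l) * (qbinom q N l * (qpoch q q l * qpoch q q m))"
      unfolding k qpoch_self_Suc[of q l] by (simp add: N algebra_simps)
    also have "\<dots> = qpoch q q N * (1 - q ^ m * q ^ Suc l)"
      unfolding left right by (simp add: algebra_simps)
    also have "\<dots> = qpoch q q (m + k)"
      using N k by (simp add: qpoch_Suc power_add mult_ac)
    finally show ?thesis .
  qed
qed

lemma qbinom_eq:
  assumes "norm q < 1" "k \<le> n"
  shows "qbinom q n k = qpoch q q n * inverse (qpoch q q k) * inverse (qpoch q q (n - k))"
  using qbinom_mult_qpoch[of q "n - k" k] assms qpoch_self_nonzero[OF assms(1)]
  by (simp add: field_simps)

lemma qbinom_bounded:
  assumes "norm q < 1"
  obtains K where "K > 0" "\<And>n k. norm (qbinom q n k) \<le> K"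
proof -
  obtain K where K: "K > 0" "\<And>n. norm (qpoch q q n) \<le> K"
    using qpoch_bounded[OF assms] by blast
  obtain L where L: "L > 0" "\<And>n. norm (inverse (qpoch q q n)) \<le> L"
    using inverse_qpoch_self_bounded[OF assms] by blast
  have "norm (qbinom q n k) \<le> K * L * L" for n k
  proof (cases "k \<le> n")
    case True
    then show ?thesis
      unfolding qbinom_eq[OF assms True] norm_mult
      by (intro mult_mono K L mult_nonneg_nonneg) (use K(1) L(1) in auto)
  next
    case False
    then show ?thesis using K L by (simp add: qbinom_eq_0)
  qed
  then show ?thesis using that[of "K * L * L"] K L by simp
qed

text \<open>
  The homogeneous form, with \<open>u\<close> in place of 1, lets the triple product be derived without
  negative powers of \<open>q\<close>: there \<open>u\<close> is a power of \<open>q\<close>.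
\<close>

lemma q_binomial_theorem:
  "(\<Prod>k<n. u + x * q ^ k) = (\<Sum>j\<le>n. q ^ (j choose 2) * qbinom q n j * x ^ j * u ^ (n - j))"
proof (induction n)
  case 0
  then show ?case by (simp add: numeral_2_eq_2)
next
  case (Suc n)
  let ?t = "\<lambda>n j. q ^ (j choose 2) * qbinom q n j * x ^ j * u ^ (n - j)"
  have "(\<Sum>j\<le>Suc n. ?t (Suc n) j)
      = u ^ Suc n + (\<Sum>j\<le>n. ?t (Suc n) (Suc j))"
    unfolding sum.atMost_Suc_shift[of _ n] by (simp add: numeral_2_eq_2)
  also have "(\<Sum>j\<le>n. ?t (Suc n) (Suc j))
      = (\<Sum>j\<le>n. q ^ (Suc j choose 2) * qbinom q n (Suc j) * x ^ Suc j * u ^ (n - j))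
        + (\<Sum>j\<le>n. x * q ^ n * ?t n j)"
    unfolding sum.distrib[symmetric]
  proof (rule sum.cong)
    fix j assume "j \<in> {..n}"
    then have "q ^ n = q ^ j * q ^ (n - j)" by (simp flip: power_add)
    then show "?t (Suc n) (Suc j)
        = q ^ (Suc j choose 2) * qbinom q n (Suc j) * x ^ Suc j * u ^ (n - j)
          + x * q ^ n * ?t n j"
      by (simp add: Suc_choose_two power_add algebra_simps)
  qed simp
  also have "u ^ Suc n
        + ((\<Sum>j\<le>n. q ^ (Suc j choose 2) * qbinom q n (Suc j) * x ^ Suc j * u ^ (n - j))
          + (\<Sum>j\<le>n. x * q ^ n * ?t n j))
      = (\<Sum>j\<le>Suc n. q ^ (j choose 2) * qbinom q n j * x ^ j * u ^ (Suc n - j))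
        + (\<Sum>j\<le>n. x * q ^ n * ?t n j)"
    unfolding sum.atMost_Suc_shift by (simp add: numeral_2_eq_2)
  also have "(\<Sum>j\<le>Suc n. q ^ (j choose 2) * qbinom q n j * x ^ j * u ^ (Suc n - j))
      = (\<Sum>j\<le>n. u * ?t n j)"
    unfolding sum.atMost_Suc
    by (simp add: qbinom_eq_0) (intro sum.cong, auto simp: Suc_diff_le)
  also have "(\<Sum>j\<le>n. u * ?t n j) + (\<Sum>j\<le>n. x * q ^ n * ?t n j)
      = (u + x * q ^ n) * (\<Sum>j\<le>n. ?t n j)"
    by (simp only: sum_distrib_left distrib_right sum.distrib)
  finally show ?case
    by (simp add: Suc.IH mult.commute)
qed

text \<open>
  Tannery's theorem for sums whose partial identities are known: if the \<open>n\<close>-th series has sum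
  \<open>s n\<close>, then the termwise limit series has the sum \<open>lim s\<close>.
\<close>

lemma sums_by_dominated_limit:
  fixes a :: "nat \<Rightarrow> nat \<Rightarrow> complex"
  assumes lim: "\<And>k. a k \<longlonglongrightarrow> b k"
    and bound: "\<And>k n. norm (a k n) \<le> M k" and "summable M"
    and sums: "\<And>n. (\<lambda>k. a k n) sums s n" and "s \<longlonglongrightarrow> l"
  shows "b sums l"
proof -
  have "summable (\<lambda>k. norm (b k)) \<and> (\<lambda>n. \<Sum>k. a k n) \<longlonglongrightarrow> suminf b"
    using tannerys_theorem[where a = a and b = b and M = M and F = sequentially] lim bound \<open>summable M\<close> by (auto intro: always_eventually)
  moreover have "(\<Sum>k. a k n) = s n" for n
    using sums_unique[OF sums[of n]] by simp
  ultimately show ?thesis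
    using \<open>s \<longlonglongrightarrow> l\<close> LIMSEQ_unique summable_norm_cancel
    by (metis (no_types, lifting) ext summable_sums)
qed

text \<open>
  The limit \<open>n \<rightarrow> \<infinity>\<close> of the \<open>q\<close>-binomial theorem with \<open>u = 1\<close>, since the Gaussian binomials
  tend to \<open>1 / (q;q)_k\<close> and are uniformly bounded.
\<close>

lemma euler_sums:
  assumes "norm q < 1"
  shows "(\<lambda>n. x ^ n * q ^ (n choose 2) / qpoch q q n) sums qpoch_inf (- x) q"
proof -
  obtain K where K: "K > 0" "\<And>n k. norm (qbinom q n k) \<le> K"
    using qbinom_bounded[OF assms] by blast
  define a where "a k n = (if k \<le> n then x ^ k * q ^ (k choose 2) * qbinom q n k else 0)" for k n
  have lim: "(\<lambda>n. a k n) \<longlonglongrightarrow> x ^ k * q ^ (k choose 2) / qpoch q q k" for k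
  proof -
    have "(\<lambda>n. x ^ k * q ^ (k choose 2) * (qpoch q q n * inverse (qpoch q q k)
            * inverse (qpoch q q (n - k))))
        \<longlonglongrightarrow> x ^ k * q ^ (k choose 2) * (qpoch_inf q q * inverse (qpoch q q k)
            * inverse (qpoch_inf q q))"
      using assms
      by (intro tendsto_mult tendsto_const tendsto_inverse qpoch_tendsto qpoch_inf_self_nonzero
          seq_offset_neg)
    also have "x ^ k * q ^ (k choose 2) * (qpoch_inf q q * inverse (qpoch q q k)
            * inverse (qpoch_inf q q)) = x ^ k * q ^ (k choose 2) / qpoch q q k"
      using qpoch_inf_self_nonzero[OF assms] by (simp add: field_simps)
    finally show ?thesis
      by (rule Lim_transform_eventually)
        (use assms in \<open>auto intro!: eventually_mono[OF eventually_ge_at_top[of k]] simp: a_def qbinom_eq\<close>)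
  qed
  have bound: "norm (a k n) \<le> norm (x ^ k * q ^ (k choose 2)) * K" for k n
    using K by (auto simp: a_def norm_mult intro!: mult_left_mono)
  have "(\<lambda>k. a k n) sums qpoch (- x) q n" for n
  proof -
    have "(\<lambda>k. a k n) sums (\<Sum>k\<le>n. a k n)"
      by (rule sums_finite) (auto simp: a_def)
    also have "(\<Sum>k\<le>n. a k n) = (\<Prod>k<n. 1 + x * q ^ k)"
      unfolding q_binomial_theorem by (intro sum.cong) (auto simp: a_def)
    finally show ?thesis by (simp add: qpoch_def)
  qed
  then show ?thesis
    by (intro sums_by_dominated_limit[where a = a, OF lim bound _ _ qpoch_tendsto[OF assms]]
        summable_mult2 summable_power_choose_two[OF assms])
qed

section \<open>Jacobi's triple product\<close>

text \<open>
  The factors with \<open>k \<ge> n\<close> give \<open>(z;q)_n\<close> after extracting \<open>q^n\<close>; the factors with \<open>k < n\<close> give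
  \<open>(y;q)_n\<close> in reverse order after extracting \<open>- z q^k\<close>, because \<open>q^n = z y q^(n-1)\<close>.
\<close>

lemma shifted_q_binomial_product:
  fixes q :: complex
  assumes "z * y = q"
  shows "(\<Prod>k<2*n. q ^ n - z * q ^ k)
    = (- z) ^ n * q ^ ((n choose 2) + n\<^sup>2) * (qpoch z q n * qpoch y q n)"
proof -
  have "(\<Prod>k<2*n. q ^ n - z * q ^ k)
      = (\<Prod>k<n. q ^ n - z * q ^ k) * (\<Prod>k<n. q ^ n - z * q ^ (n + k))"
    using prod.atLeastLessThan_concat[of 0 n "2*n" "\<lambda>k. q ^ n - z * q ^ k"]
      prod.shift_bounds_nat_ivl[of "\<lambda>k. q ^ n - z * q ^ k" 0 n n]
    by (simp add: lessThan_atLeast0 mult_2 add.commute)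
  also have "(\<Prod>k<n. q ^ n - z * q ^ (n + k)) = (\<Prod>k<n. q ^ n) * qpoch z q n"
    unfolding qpoch_def prod.distrib[symmetric]
    by (intro prod.cong) (auto simp: power_add algebra_simps)
  also have "(\<Prod>k<n. q ^ n) = q ^ n\<^sup>2"
    by (simp add: power2_eq_square power_mult)
  also have "(\<Prod>k<n. q ^ n - z * q ^ k)
      = (\<Prod>k<n. - z * q ^ k * (1 - y * q ^ (n - Suc k)))"
  proof (intro prod.cong)
    fix k assume "k \<in> {..<n}"
    then have "q ^ n = q * q ^ k * q ^ (n - Suc k)"
      by (simp flip: power_add power_Suc)
    then show "q ^ n - z * q ^ k = - z * q ^ k * (1 - y * q ^ (n - Suc k))"
      using assms by (simp add: algebra_simps)
  qed simp
  also have "\<dots> = (\<Prod>k<n. - z) * (\<Prod>k<n. q ^ k) * (\<Prod>k<n. 1 - y * q ^ (n - Suc k))"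
    by (simp only: prod.distrib)
  also have "(\<Prod>k<n. 1 - y * q ^ (n - Suc k)) = qpoch y q n"
    unfolding qpoch_def by (rule prod.nat_diff_reindex)
  also have "(\<Prod>k<n. q ^ k) = q ^ (n choose 2)"
    by (induction n) (auto simp: Suc_choose_two power_add numeral_2_eq_2)
  finally show ?thesis
    by (simp add: power_add mult_ac)
qed

text \<open>
  Expand the preceding product by the \<open>q\<close>-binomial theorem, centre the summation index at \<open>n\<close>,
  and cancel the common monomial \<open>c\<close>.  The first sum collects the indices \<open>n + r\<close>, the second the
  indices \<open>n - 1 - r\<close>, where \<open>z y = q\<close> turns missing powers of \<open>z\<close> into powers of \<open>y\<close>.
\<close>

lemma finite_jacobi_triple_product:
  assumes "q \<noteq> 0" "z * y = q"
  shows "qpoch z q n * qpoch y q n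
    = (\<Sum>r\<le>n. (- z) ^ r * q ^ (r choose 2) * qbinom q (2*n) (n + r))
      + (\<Sum>r<n. (- y) ^ Suc r * q ^ (Suc r choose 2) * qbinom q (2*n) (n - Suc r))"
proof -
  define c where "c = (- z) ^ n * q ^ ((n choose 2) + n\<^sup>2)"
  have "z \<noteq> 0" using assms by auto
  then have "c \<noteq> 0" using assms by (simp add: c_def)
  let ?t = "\<lambda>j. q ^ (j choose 2) * qbinom q (2*n) j * (- z) ^ j * (q ^ n) ^ (2*n - j)"
  have "c * (qpoch z q n * qpoch y q n) = (\<Sum>j\<le>2*n. ?t j)"
    using shifted_q_binomial_product[OF assms(2), of n]
      q_binomial_theorem[of "q ^ n" "- z" q "2*n"] by (simp add: c_def)
  also have "\<dots> = (\<Sum>j<n. ?t j) + (\<Sum>r\<le>n. ?t (n + r))"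
    using sum.atLeastLessThan_concat[of 0 n "Suc (2*n)" ?t]
      sum.shift_bounds_nat_ivl[of ?t 0 n "Suc n"]
    by (simp add: lessThan_Suc_atMost[symmetric] lessThan_atLeast0 mult_2 add.commute)
  also have "(\<Sum>j<n. ?t j) = (\<Sum>r<n. ?t (n - Suc r))"
    by (rule sum.nat_diff_reindex[symmetric])
  also have "\<dots> = (\<Sum>r<n. c * ((- y) ^ Suc r * q ^ (Suc r choose 2) * qbinom q (2*n) (n - Suc r)))"
  proof (intro sum.cong)
    fix r assume "r \<in> {..<n}"
    define m where "m = n - Suc r"
    then have n: "n = m + Suc r" using \<open>r \<in> {..<n}\<close> by simp
    have e: "(m choose 2) + n * (2*n - m) = (n choose 2) + n\<^sup>2 + Suc r + (Suc r choose 2)"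
      using twice_choose_two[of "Suc r"]
      by (simp add: n Suc_choose_two add_choose_two algebra_simps power2_eq_square)
    have zy: "(- z) ^ m * q ^ Suc r = (- z) ^ n * (- y) ^ Suc r"
      by (simp add: n power_add power_mult_distrib flip: assms(2)) (simp add: power_minus[of y] power_minus[of z])
    have pow: "q ^ (m choose 2) * (q ^ n) ^ (2*n - m)
        = q ^ ((n choose 2) + n\<^sup>2 + (Suc r choose 2)) * q ^ Suc r"
      unfolding power_mult[symmetric] power_add[symmetric] e by (simp add: ac_simps)
    have "?t m = (q ^ (m choose 2) * (q ^ n) ^ (2*n - m)) * (- z) ^ m * qbinom q (2*n) m"
      by (simp only: mult_ac)
    also have "\<dots> = q ^ ((n choose 2) + n\<^sup>2) * q ^ (Suc r choose 2)
        * ((- z) ^ m * q ^ Suc r) * qbinom q (2*n) m"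
      unfolding pow by (simp only: power_add mult_ac)
    also have "\<dots> = c * ((- y) ^ Suc r * q ^ (Suc r choose 2) * qbinom q (2*n) m)"
      unfolding zy c_def by (simp only: mult_ac)
    finally show "?t (n - Suc r) = c * ((- y) ^ Suc r * q ^ (Suc r choose 2) * qbinom q (2*n) (n - Suc r))"
      by (simp only: m_def)
  qed simp
  also have "(\<Sum>r\<le>n. ?t (n + r))
      = (\<Sum>r\<le>n. c * ((- z) ^ r * q ^ (r choose 2) * qbinom q (2*n) (n + r)))"
  proof (intro sum.cong)
    fix r assume "r \<in> {..n}"
    then obtain m where n: "n = m + r" by (metis add.commute atMost_iff le_Suc_ex)
    have e: "((n + r) choose 2) + n * m = (n choose 2) + n\<^sup>2 + (r choose 2)"
      using twice_choose_two[of "r"]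
      by (simp add: n add_choose_two algebra_simps power2_eq_square)
    have "2 * n - (n + r) = m" by (simp add: n)
    then have "q ^ ((n + r) choose 2) * (q ^ n) ^ (2*n - (n + r)) = q ^ ((n choose 2) + n\<^sup>2) * q ^ (r choose 2)"
      unfolding power_mult[symmetric] power_add[symmetric] e[symmetric] by simp
    then show "?t (n + r) = c * ((- z) ^ r * q ^ (r choose 2) * qbinom q (2*n) (n + r))"
      by (simp add: c_def power_add mult_ac)
  qed simp
  finally have "c * (qpoch z q n * qpoch y q n)
    = c * ((\<Sum>r\<le>n. (- z) ^ r * q ^ (r choose 2) * qbinom q (2*n) (n + r))
      + (\<Sum>r<n. (- y) ^ Suc r * q ^ (Suc r choose 2) * qbinom q (2*n) (n - Suc r)))"
    by (simp add: sum_distrib_left distrib_left)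
  then show ?thesis using \<open>c \<noteq> 0\<close> by simp
qed

lemma qbinom_tendsto:
  assumes "norm q < 1" "filterlim N at_top sequentially" "filterlim k at_top sequentially"
    "filterlim m at_top sequentially" "\<forall>\<^sub>F n in sequentially. N n = m n + k n"
  shows "(\<lambda>n. qbinom q (N n) (k n)) \<longlonglongrightarrow> inverse (qpoch_inf q q)"
proof -
  have *: "(\<lambda>n. qpoch q q (f n)) \<longlonglongrightarrow> qpoch_inf q q" if "filterlim f at_top sequentially" for f
    using filterlim_compose[OF qpoch_tendsto[OF assms(1)] that] .
  have "(\<lambda>n. qpoch q q (N n) * inverse (qpoch q q (k n)) * inverse (qpoch q q (m n)))
      \<longlonglongrightarrow> qpoch_inf q q * inverse (qpoch_inf q q) * inverse (qpoch_inf q q)"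
    using assms by (intro tendsto_mult tendsto_inverse * qpoch_inf_self_nonzero)
  also have "qpoch_inf q q * inverse (qpoch_inf q q) * inverse (qpoch_inf q q)
      = inverse (qpoch_inf q q)"
    using qpoch_inf_self_nonzero[OF assms(1)] by simp
  finally show ?thesis
    by (rule Lim_transform_eventually)
      (use assms(5) in \<open>auto elim!: eventually_mono simp: qbinom_eq[OF assms(1)]\<close>)
qed

text \<open>
  The bilateral series \<open>\<Sum>r. (-z)^r q^(r choose 2)\<close> is folded at \<open>r = 0\<close>: with \<open>y = q/z\<close>, the
  term of index \<open>- (r+1)\<close> is \<open>(-y)^(r+1) q^((r+1) choose 2)\<close>.  It arises as the limit of the
  finite identity, in which every Gaussian binomial tends to \<open>1 / (q;q)_\<infinity>\<close>.
\<close>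

lemma jacobi_triple_product:
  assumes q: "norm q < 1" and "q \<noteq> 0" "z * y = q"
  shows "(\<lambda>r. (- z) ^ r * q ^ (r choose 2) + (- y) ^ Suc r * q ^ (Suc r choose 2))
    sums (qpoch_inf z q * qpoch_inf y q * qpoch_inf q q)"
proof -
  obtain K where K: "K > 0" "\<And>n k. norm (qbinom q n k) \<le> K"
    using qbinom_bounded[OF q] by blast
  let ?u = "\<lambda>r. (- z) ^ r * q ^ (r choose 2)"
  let ?v = "\<lambda>r. (- y) ^ r * q ^ (r choose 2)"
  define a where "a r n = (if r \<le> n then ?u r * qbinom q (2*n) (n + r) else 0)
    + (if r < n then ?v (Suc r) * qbinom q (2*n) (n - Suc r) else 0)" for r n
  define M where "M r = norm (?u r) * K + norm (?v (Suc r)) * K" for r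
  have double: "filterlim (\<lambda>n. 2 * n :: nat) at_top sequentially"
    by (rule filterlim_subseq) (auto simp: strict_mono_def)
  have lim: "a r \<longlonglongrightarrow> (?u r + ?v (Suc r)) * inverse (qpoch_inf q q)" for r
  proof -
    have "(\<lambda>n. qbinom q (2*n) (n + r)) \<longlonglongrightarrow> inverse (qpoch_inf q q)"
      by (rule qbinom_tendsto[OF q, where m = "\<lambda>n. n - r"])
        (auto intro!: eventually_mono[OF eventually_ge_at_top[of r]] double
          filterlim_minus_const_nat_at_top filterlim_add_const_nat_at_top)
    moreover have "(\<lambda>n. qbinom q (2*n) (n - Suc r)) \<longlonglongrightarrow> inverse (qpoch_inf q q)"
      by (rule qbinom_tendsto[OF q, where m = "\<lambda>n. n + Suc r"])
        (auto intro!: eventually_mono[OF eventually_gt_at_top[of r]] double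
          filterlim_minus_const_nat_at_top filterlim_add_const_nat_at_top simp del: add_Suc_right)
    ultimately have "(\<lambda>n. ?u r * qbinom q (2*n) (n + r) + ?v (Suc r) * qbinom q (2*n) (n - Suc r))
        \<longlonglongrightarrow> ?u r * inverse (qpoch_inf q q) + ?v (Suc r) * inverse (qpoch_inf q q)"
      by (intro tendsto_intros)
    then show ?thesis
      unfolding distrib_right
      by (rule Lim_transform_eventually)
        (auto intro!: eventually_mono[OF eventually_gt_at_top[of r]] simp: a_def)
  qed
  have bound: "norm (a r n) \<le> M r" for r n
    unfolding a_def M_def
    by (intro norm_triangle_le add_mono) (use K in \<open>auto simp: norm_mult intro!: mult_left_mono\<close>)
  have summable: "summable M"
    unfolding M_def
    by (intro summable_add summable_mult2 summable_power_choose_two[OF q])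
      (rule summable_Suc_iff[THEN iffD2, OF summable_power_choose_two[OF q]])
  have "(\<lambda>r. a r n) sums (qpoch z q n * qpoch y q n)" for n
  proof -
    have "(\<lambda>r. if r \<le> n then ?u r * qbinom q (2*n) (n + r) else 0)
        sums (\<Sum>r\<le>n. ?u r * qbinom q (2*n) (n + r))"
      using sums_If_finite_set[of "{..n}"] by simp
    moreover have "(\<lambda>r. if r < n then ?v (Suc r) * qbinom q (2*n) (n - Suc r) else 0)
        sums (\<Sum>r<n. ?v (Suc r) * qbinom q (2*n) (n - Suc r))"
      using sums_If_finite_set[of "{..<n}"] by (simp del: power_Suc)
    ultimately show ?thesis
      unfolding a_def finite_jacobi_triple_product[OF assms(2,3)] by (rule sums_add)
  qed
  then have "(\<lambda>r. (?u r + ?v (Suc r)) * inverse (qpoch_inf q q))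
      sums (qpoch_inf z q * qpoch_inf y q)"
    by (rule sums_by_dominated_limit[where a = a, OF lim bound summable])
      (intro tendsto_mult qpoch_tendsto q)
  from sums_mult2[OF this, of "qpoch_inf q q"] show ?thesis
    using qpoch_inf_self_nonzero[OF q] by (simp add: mult.assoc del: power_Suc)
qed

section \<open>Uniqueness for the Rogers-Ramanujan recurrence\<close>

lemma product_one_plus_power_bounded:
  fixes r :: real
  assumes "0 \<le> r" "r < 1"
  shows "(\<Prod>k\<in>A. 1 + r ^ Suc k) \<le> exp (1 / (1 - r))"
proof (cases "finite A")
  case True
  have "(\<Prod>k\<in>A. 1 + r ^ Suc k) \<le> exp (\<Sum>k\<in>A. r ^ Suc k)"
    using assms by (intro prod_le_exp_sum) auto
  also have "(\<Sum>k\<in>A. r ^ Suc k) \<le> (\<Sum>k\<in>A. r ^ k)"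
    using assms by (intro sum_mono) (auto intro: mult_left_le_one_le)
  also have "(\<Sum>k\<in>A. r ^ k) \<le> (\<Sum>k. r ^ k)"
    using assms True by (intro sum_le_suminf) auto
  also have "\<dots> = 1 / (1 - r)"
    using assms by (simp add: suminf_geometric)
  finally show ?thesis by simp
next
  case False
  then show ?thesis using assms by simp
qed

text \<open>
  Going one step down the recurrence enlarges a common bound for two consecutive terms by at
  most the factor \<open>1 + norm q ^ (n+1)\<close>.  The product of all these factors converges, so a bound
  valid far out persists at every index up to a fixed constant; far out the bound is
  arbitrarily small.
\<close>

lemma null_sequence_of_recurrence_eq_0:
  fixes x :: "nat \<Rightarrow> complex"
  assumes q: "norm q < 1"
    and rec: "\<And>n. x n = x (Suc n) + q ^ Suc n * x (Suc (Suc n))"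
    and "x \<longlonglongrightarrow> 0"
  shows "x n = 0"
proof -
  let ?r = "norm q"
  have "norm (x n) \<le> 0"
  proof (rule field_le_epsilon)
    fix e :: real assume "e > 0"
    \<comment> \<open>the total loss in descending from \<open>N\<close> to \<open>n\<close> is at most \<open>exp (1 / (1 - norm q))\<close>\<close>
    define d where "d = e / exp (1 / (1 - ?r))"
    have "d > 0" using \<open>e > 0\<close> by (simp add: d_def)
    obtain N0 where N0: "norm (x m) \<le> d" if "m \<ge> N0" for m
      using LIMSEQ_D[OF \<open>x \<longlonglongrightarrow> 0\<close> \<open>d > 0\<close>] by (auto intro: less_imp_le)
    define N where "N = max n N0"
    let ?P = "\<lambda>m. \<Prod>k=m..<N. 1 + ?r ^ Suc k"
    have "norm (x n) \<le> d * ?P n \<and> norm (x (Suc n)) \<le> d * ?P n"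
    proof (rule inc_induct[of n N])
      show "n \<le> N" by (simp add: N_def)
      show "norm (x N) \<le> d * ?P N \<and> norm (x (Suc N)) \<le> d * ?P N"
        using N0 by (simp add: N_def)
    next
      fix m assume m: "m < N"
        and IH: "norm (x (Suc m)) \<le> d * ?P (Suc m) \<and> norm (x (Suc (Suc m))) \<le> d * ?P (Suc m)"
      have P: "?P m = (1 + ?r ^ Suc m) * ?P (Suc m)"
        using m by (rule prod.atLeast_Suc_lessThan)
      have "norm (x m) \<le> norm (x (Suc m)) + ?r ^ Suc m * norm (x (Suc (Suc m)))"
        using norm_triangle_ineq[of "x (Suc m)" "q ^ Suc m * x (Suc (Suc m))"]
        by (simp only: rec[of m, symmetric] norm_mult norm_power)
      also have "\<dots> \<le> d * ?P (Suc m) + ?r ^ Suc m * (d * ?P (Suc m))"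
        using IH by (intro add_mono mult_left_mono) auto
      finally have "norm (x m) \<le> d * ?P m"
        unfolding P by (simp add: algebra_simps)
      moreover have "1 * (d * ?P (Suc m)) \<le> (1 + ?r ^ Suc m) * (d * ?P (Suc m))"
        using \<open>d > 0\<close> by (intro mult_right_mono mult_nonneg_nonneg prod_nonneg) auto
      then have "norm (x (Suc m)) \<le> d * ?P m"
        unfolding P using IH by (simp add: algebra_simps)
      ultimately show "norm (x m) \<le> d * ?P m \<and> norm (x (Suc m)) \<le> d * ?P m" ..
    qed
    then have "norm (x n) \<le> d * ?P n" ..
    also have "\<dots> \<le> d * exp (1 / (1 - ?r))"
      using q \<open>d > 0\<close> by (intro mult_left_mono product_one_plus_power_bounded) auto
    finally show "norm (x n) \<le> 0 + e" by (simp add: d_def)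
  qed
  then show ?thesis by simp
qed

section \<open>The Rogers-Ramanujan sums\<close>

definition rr_term :: "complex \<Rightarrow> nat \<Rightarrow> nat \<Rightarrow> complex" where
  "rr_term q n k = q ^ (k\<^sup>2 + n * k) / qpoch q q k"

definition rr_sum :: "complex \<Rightarrow> nat \<Rightarrow> complex" where
  "rr_sum q n = (\<Sum>k. rr_term q n k)"

lemma rr_term_bounded:
  assumes "norm q < 1"
  obtains K where "K > 0" "\<And>n k. norm (rr_term q n k) \<le> K * norm q ^ k"
proof -
  obtain K where K: "K > 0" "\<And>k. norm (inverse (qpoch q q k)) \<le> K"
    using inverse_qpoch_self_bounded[OF assms] by blast
  have "norm (rr_term q n k) \<le> K * norm q ^ k" for n k
  proof -
    have "k \<le> k\<^sup>2 + n * k"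
      by (simp add: power2_nat_le_imp_le trans_le_add1 power2_eq_square)
    then have "norm q ^ (k\<^sup>2 + n * k) \<le> norm q ^ k"
      using assms by (intro power_decreasing) auto
    then have "norm (inverse (qpoch q q k)) * norm q ^ (k\<^sup>2 + n * k) \<le> K * norm q ^ k"
      using K by (intro mult_mono) auto
    then show ?thesis
      by (simp add: rr_term_def norm_divide norm_power norm_inverse field_simps)
  qed
  then show ?thesis using K that by blast
qed

lemma summable_rr_term:
  assumes "norm q < 1"
  shows "summable (rr_term q n)"
proof -
  obtain K where "\<And>n k. norm (rr_term q n k) \<le> K * norm q ^ k"
    using rr_term_bounded[OF assms] by blast
  moreover have "summable (\<lambda>k. K * norm q ^ k)"
    using assms by (intro summable_mult summable_geometric) auto
  ultimately show ?thesis
    by (intro summable_comparison_test[of "rr_term q n" "\<lambda>k. K * norm q ^ k"]) auto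
qed

text \<open>
  In \<open>S n - S (n+1)\<close> the factor \<open>1 - q^k\<close> appears; it removes the term \<open>k = 0\<close> and cancels the
  last factor of \<open>(q;q)_k\<close>, after which the index shift gives \<open>q^(n+1) S (n+2)\<close>.
\<close>

lemma rr_sum_rec:
  assumes "norm q < 1"
  shows "rr_sum q n = rr_sum q (Suc n) + q ^ Suc n * rr_sum q (Suc (Suc n))"
proof -
  note [simp] = summable_rr_term[OF assms]
  have step: "rr_term q n (Suc k) - rr_term q (Suc n) (Suc k)
      = q ^ Suc n * rr_term q (Suc (Suc n)) k" for k
  proof -
    have "rr_term q n (Suc k) - rr_term q (Suc n) (Suc k)
        = q ^ ((Suc k)\<^sup>2 + n * Suc k) * (1 - q ^ Suc k) / qpoch q q (Suc k)"
      by (simp add: rr_term_def power_add diff_divide_distrib algebra_simps)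
    also have "\<dots> = q ^ ((Suc k)\<^sup>2 + n * Suc k) / qpoch q q k"
      using one_minus_power_Suc_nonzero[OF assms, of k] by (simp add: qpoch_self_Suc)
    also have "(Suc k)\<^sup>2 + n * Suc k = Suc n + (k\<^sup>2 + Suc (Suc n) * k)"
      by (simp add: power2_eq_square algebra_simps)
    finally show ?thesis by (simp add: rr_term_def power_add)
  qed
  have "rr_sum q n - rr_sum q (Suc n) = (\<Sum>k. rr_term q n k - rr_term q (Suc n) k)"
    unfolding rr_sum_def by (rule suminf_diff) simp_all
  also have "\<dots> = (\<Sum>k. rr_term q n (Suc k) - rr_term q (Suc n) (Suc k))"
    using suminf_split_head[OF summable_diff, of "rr_term q n" "rr_term q (Suc n)"]
    by (simp add: rr_term_def[of q _ 0])
  also have "\<dots> = q ^ Suc n * rr_sum q (Suc (Suc n))"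
    unfolding step rr_sum_def by (rule suminf_mult) simp
  finally show ?thesis by (simp add: algebra_simps)
qed

lemma power_mult_tendsto_0:
  fixes q :: complex
  assumes "norm q < 1" "k > 0"
  shows "(\<lambda>n. q ^ (n * k)) \<longlonglongrightarrow> 0"
  using LIMSEQ_power_zero[OF norm_power_less_one[OF assms]]
  by (simp add: power_mult[symmetric] mult.commute)

lemma rr_sum_tendsto:
  assumes "norm q < 1"
  shows "rr_sum q \<longlonglongrightarrow> 1"
proof -
  obtain K where K: "\<And>n k. norm (rr_term q n k) \<le> K * norm q ^ k"
    using rr_term_bounded[OF assms] by blast
  have "(\<lambda>n. rr_term q n k) \<longlonglongrightarrow> (if k = 0 then 1 else 0)" for k
  proof (cases "k = 0")
    case False
    then have "(\<lambda>n. q ^ k\<^sup>2 / qpoch q q k * q ^ (n * k)) \<longlonglongrightarrow> q ^ k\<^sup>2 / qpoch q q k * 0"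
      using assms by (intro tendsto_mult tendsto_const power_mult_tendsto_0) auto
    then show ?thesis using False by (simp add: rr_term_def power_add)
  qed (simp add: rr_term_def)
  moreover have "summable (\<lambda>k. K * norm q ^ k)"
    using assms by (intro summable_mult summable_geometric) auto
  ultimately have "(\<lambda>n. \<Sum>k. rr_term q n k) \<longlonglongrightarrow> (\<Sum>k. if k = 0 then 1 else 0)"
    using K tannerys_theorem[where a = "\<lambda>k n. rr_term q n k" and b = "\<lambda>k. if k = 0 then 1 else 0"
        and M = "\<lambda>k. K * norm q ^ k" and F = sequentially]
    by (auto intro: always_eventually)
  then show ?thesis
    by (simp add: rr_sum_def[abs_def] sums_unique[OF sums_single, symmetric])
qed

section \<open>The theta-like series with the same recurrence\<close>

text \<open>
  This is a common factor of the terms of Hardy and Wright's functions \<open>H_1(a)\<close> and \<open>H_2(a)\<close> at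
  \<open>a = q^(n+1)\<close>, multiplied by \<open>(q;q)_\<infinity>\<close>; \<open>theta_term\<close> belongs to \<open>H_2\<close> and \<open>theta_term1\<close> to \<open>H_1\<close>.
  The multiplication turns the product \<open>1 / (a q^r;q)_\<infinity>\<close> into the finite symbol
  \<open>(q;q)_(r+n)\<close>.
\<close>

definition theta_coeff :: "complex \<Rightarrow> nat \<Rightarrow> nat \<Rightarrow> complex" where
  "theta_coeff q n r = (- 1) ^ r * q ^ (2 * r * n + 5 * (r choose 2)) * qpoch q q (r + n) / qpoch q q r"

definition theta_term :: "complex \<Rightarrow> nat \<Rightarrow> nat \<Rightarrow> complex" where
  "theta_term q n r = theta_coeff q n r * q ^ (3 * r) * (1 - q ^ (2 * n + 2 + 4 * r))"

definition theta_sum :: "complex \<Rightarrow> nat \<Rightarrow> complex" where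
  "theta_sum q n = (\<Sum>r. theta_term q n r)"

definition theta_term1 :: "complex \<Rightarrow> nat \<Rightarrow> nat \<Rightarrow> complex" where
  "theta_term1 q n r = theta_coeff q n r * q ^ (4 * r) * (1 - q ^ (n + 1 + 2 * r))"

lemma theta_coeff_bounded:
  assumes "norm q < 1"
  obtains K where "K > 0" "\<And>n r. norm (theta_coeff q n r) \<le> K"
proof -
  obtain K where K: "K > 0" "\<And>n. norm (qpoch q q n) \<le> K"
    using qpoch_bounded[OF assms] by blast
  obtain L where L: "L > 0" "\<And>n. norm (inverse (qpoch q q n)) \<le> L"
    using inverse_qpoch_self_bounded[OF assms] by blast
  have "norm (theta_coeff q n r) \<le> 1 * K * L" for n r
    unfolding theta_coeff_def divide_inverse norm_mult
    using assms K L
    by (intro mult_mono mult_nonneg_nonneg) (auto simp: norm_power intro!: power_le_one mult_le_one)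
  then show ?thesis using that[of "K * L"] K L by simp
qed

lemma norm_one_minus_power_le:
  fixes q :: complex
  assumes "norm q < 1"
  shows "norm (1 - q ^ n) \<le> 2"
proof -
  have "norm (1 - q ^ n) \<le> norm (1 :: complex) + norm (q ^ n)" by (rule norm_triangle_ineq4)
  also have "norm (q ^ n) \<le> 1" using assms by (simp add: norm_power power_le_one)
  finally show ?thesis by simp
qed

text \<open>
  The geometric majorant does not depend on \<open>n\<close>; summability and the limit \<open>n \<rightarrow> \<infinity>\<close> under
  the sum both follow from it.
\<close>

lemma theta_series_bounded:
  assumes "norm q < 1"
  shows "\<exists>K. \<forall>n r s m. r \<le> s \<longrightarrow> norm (theta_coeff q n r * q ^ s * (1 - q ^ m)) \<le> K * norm q ^ r"
proof -
  obtain K where K: "K > 0" "\<And>n r. norm (theta_coeff q n r) \<le> K"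
    using theta_coeff_bounded[OF assms] by blast
  have "norm (theta_coeff q n r * q ^ s * (1 - q ^ m)) \<le> K * norm q ^ r * 2" if "s \<ge> r" for n r s m
    unfolding norm_mult norm_power using assms K that norm_one_minus_power_le[OF assms]
    by (intro mult_mono mult_nonneg_nonneg power_decreasing) auto
  then show ?thesis by (intro exI[of _ "K * 2"]) (simp add: mult_ac)
qed

lemma summable_theta_series:
  assumes "norm q < 1" "\<And>r. s r \<ge> r"
  shows "summable (\<lambda>r. theta_coeff q n r * q ^ s r * (1 - q ^ m r))"
proof -
  obtain K where K: "\<And>n r s m. r \<le> s \<Longrightarrow>
      norm (theta_coeff q n r * q ^ s * (1 - q ^ m)) \<le> K * norm q ^ r"
    using theta_series_bounded[OF assms(1)] by blast
  have "summable (\<lambda>k. K * norm q ^ k)"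
    using assms by (intro summable_mult summable_geometric) auto
  then show ?thesis
    using K[OF assms(2)] by (intro summable_comparison_test[OF _ \<open>summable (\<lambda>k. K * norm q ^ k)\<close>]) blast
qed

text \<open>
  The device behind both relations below: each term is split into a part vanishing at \<open>r = 0\<close>
  and a rest, and the first part is shifted by one so that the two recombine into a term of
  another series.
\<close>

lemma suminf_shift_first_part:
  fixes f g :: "nat \<Rightarrow> complex"
  assumes "summable f" "summable g" "f 0 = 0"
  shows "(\<Sum>r. f r + g r) = (\<Sum>r. f (Suc r) + g r)"
proof -
  have "summable (\<lambda>r. f (Suc r))" using assms by (simp add: summable_Suc_iff)
  then show ?thesis
    using assms suminf_split_head[OF assms(1)] by (simp flip: suminf_add)
qed

text \<open>
  This and the next lemma absorb the factors \<open>1 - q^(r+1)\<close> and \<open>1 - q^(r+n+1)\<close> produced by the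
  splitting into the Pochhammer symbols; either way the index \<open>n\<close> rises by one.
\<close>

lemma theta_coeff_mult_one_minus:
  assumes "norm q < 1"
  shows "theta_coeff q n (Suc r) * (1 - q ^ Suc r)
    = - (q ^ (2 * n + 3 * r) * theta_coeff q (Suc n) r)"
proof -
  have "theta_coeff q n (Suc r) * (1 - q ^ Suc r)
    = (- 1) ^ Suc r * q ^ (2 * Suc r * n + 5 * (Suc r choose 2)) * qpoch q q (Suc r + n) / qpoch q q r"
    using one_minus_power_Suc_nonzero[OF assms, of r]
    by (simp add: theta_coeff_def qpoch_self_Suc[of q r] del: add_Suc)
  also have "2 * Suc r * n + 5 * (Suc r choose 2) = 2 * n + 3 * r + (2 * r * Suc n + 5 * (r choose 2))"
    by (simp add: Suc_choose_two algebra_simps)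
  finally show ?thesis
    unfolding theta_coeff_def power_add[of q "2 * n + 3 * r"] add_Suc_shift by (simp add: mult_ac)
qed

lemma theta_coeff_mult_one_minus':
  "q ^ (2 * r) * theta_coeff q n r * (1 - q ^ Suc (r + n)) = theta_coeff q (Suc n) r"
  by (simp add: theta_coeff_def qpoch_self_Suc power_add algebra_simps)

text \<open>
  The relation \<open>H_1(a) = H_2(a q)\<close>.  The splitting uses
  \<open>1 - a q^(2 r) = (1 - q^r) + q^r (1 - a q^r)\<close> with \<open>a = q^(n+1)\<close>.
\<close>

lemma theta_sum_Suc:
  assumes "norm q < 1"
  shows "theta_sum q (Suc n) = (\<Sum>r. theta_term1 q n r)"
proof -
  let ?c = "theta_coeff q n"
  define f where "f r = ?c r * q ^ (4 * r) * (1 - q ^ r)" for r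
  define g where "g r = ?c r * q ^ (5 * r) * (1 - q ^ Suc (r + n))" for r
  have "f r + g r = theta_term1 q n r" for r
  proof -
    have "q ^ (5 * r) = q ^ (4 * r) * q ^ r"
      by (simp flip: power_add)
    moreover have "q ^ (2 * r) = q ^ r * q ^ r"
      by (simp add: power_mult power2_eq_square power_mult_distrib)
    ultimately show ?thesis
      by (simp add: f_def g_def theta_term1_def power_add algebra_simps)
  qed
  moreover have "f (Suc r) + g r = theta_term q (Suc n) r" for r
  proof -
    have "f (Suc r) = - (theta_coeff q (Suc n) r * q ^ (2 * n + 3 * r + 4 * Suc r))"
    proof -
      have "f (Suc r) = ?c (Suc r) * (1 - q ^ Suc r) * q ^ (4 * Suc r)"
        by (simp only: f_def mult_ac)
      then show ?thesis
        unfolding theta_coeff_mult_one_minus[OF assms] power_add[of q _ "4 * Suc r"]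
        by (simp add: mult_ac)
    qed
    also have "2 * n + 3 * r + 4 * Suc r = 3 * r + (2 * Suc n + 2 + 4 * r)"
      by simp
    finally have "f (Suc r)
        = - (theta_coeff q (Suc n) r * (q ^ (3 * r) * q ^ (2 * Suc n + 2 + 4 * r)))"
      by (simp only: power_add)
    moreover have "g r = q ^ (3 * r) * theta_coeff q (Suc n) r"
    proof -
      have "q ^ (5 * r) = q ^ (3 * r) * q ^ (2 * r)" by (simp flip: power_add)
      then show ?thesis
        unfolding g_def theta_coeff_mult_one_minus'[symmetric] by (simp only: mult_ac)
    qed
    ultimately show ?thesis
      by (simp add: theta_term_def algebra_simps)
  qed
  moreover have "summable f" "summable g"
    unfolding f_def[abs_def] g_def[abs_def] by (intro summable_theta_series assms; simp)+
  moreover have "f 0 = 0" by (simp add: f_def)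
  ultimately show ?thesis
    using suminf_shift_first_part[of f g] by (simp add: theta_sum_def)
qed

text \<open>
  The relation \<open>H_2(a) - H_1(a) = a H_1(a q)\<close>, combined with the previous lemma.  With
  \<open>a = q^(n+1)\<close> the splitting of the difference uses
  \<open>(1 - a^2 q^(4 r)) - q^r (1 - a q^(2 r)) = (1 - q^r) + a q^(3 r) (1 - a q^r)\<close>.
\<close>

lemma theta_sum_rec:
  assumes "norm q < 1"
  shows "theta_sum q n = theta_sum q (Suc n) + q ^ Suc n * theta_sum q (Suc (Suc n))"
proof -
  let ?c = "theta_coeff q n"
  define f where "f r = ?c r * q ^ (3 * r) * (1 - q ^ r)" for r
  define g where "g r = q ^ Suc n * (?c r * q ^ (6 * r) * (1 - q ^ Suc (r + n)))" for r
  have "f r + g r = theta_term q n r - theta_term1 q n r" for r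
  proof -
    have "q ^ (4 * r) = q ^ (3 * r) * q ^ r" "q ^ (6 * r) = q ^ (3 * r) * q ^ (3 * r)"
      by (simp_all flip: power_add)
    moreover have "q ^ (3 * r) = q ^ r * q ^ r * q ^ r" "q ^ (2 * r) = q ^ r * q ^ r"
      "q ^ (2 * n) = q ^ n * q ^ n"
      by (simp_all add: power_mult power2_eq_square power3_eq_cube power_mult_distrib)
    ultimately show ?thesis
      by (simp add: f_def g_def theta_term1_def theta_term_def power_add power2_eq_square algebra_simps)
  qed
  moreover have "f (Suc r) + g r = q ^ Suc n * theta_term1 q (Suc n) r" for r
  proof -
    have "f (Suc r) = - (theta_coeff q (Suc n) r * q ^ (2 * n + 3 * r + 3 * Suc r))"
    proof -
      have "f (Suc r) = ?c (Suc r) * (1 - q ^ Suc r) * q ^ (3 * Suc r)"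
        by (simp only: f_def mult_ac)
      then show ?thesis
        unfolding theta_coeff_mult_one_minus[OF assms] power_add[of q _ "3 * Suc r"]
        by (simp add: mult_ac)
    qed
    also have "2 * n + 3 * r + 3 * Suc r = Suc n + (4 * r + (Suc n + 1 + 2 * r))"
      by simp
    finally have "f (Suc r) = - (q ^ Suc n * (theta_coeff q (Suc n) r * (q ^ (4 * r) * q ^ (Suc n + 1 + 2 * r))))"
      by (simp only: power_add mult_ac)
    moreover have "g r = q ^ Suc n * (q ^ (4 * r) * theta_coeff q (Suc n) r)"
    proof -
      have "q ^ (6 * r) = q ^ (4 * r) * q ^ (2 * r)" by (simp flip: power_add)
      then show ?thesis
        unfolding g_def theta_coeff_mult_one_minus'[symmetric] by (simp only: mult_ac)
    qed
    ultimately show ?thesis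
      by (simp add: theta_term1_def algebra_simps)
  qed
  moreover have "summable f" "summable g"
    unfolding f_def[abs_def] g_def[abs_def] by (intro summable_mult summable_theta_series assms; simp)+
  moreover have "f 0 = 0" by (simp add: f_def)
  ultimately have "(\<Sum>r. theta_term q n r - theta_term1 q n r) = (\<Sum>r. q ^ Suc n * theta_term1 q (Suc n) r)"
    using suminf_shift_first_part[of f g] by simp
  moreover have "summable (theta_term q m)" "summable (theta_term1 q m)" for m
    unfolding theta_term_def[abs_def] theta_term1_def[abs_def] by (intro summable_theta_series assms; simp)+
  ultimately show ?thesis
    using suminf_diff[of "theta_term q n" "theta_term1 q n"]
      suminf_mult[of "theta_term1 q (Suc n)" "q ^ Suc n"]
    by (simp add: theta_sum_Suc[OF assms] theta_sum_def[of q n] diff_eq_eq add.commute)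
qed

text \<open>
  Only the term \<open>r = 0\<close>, which is \<open>(q;q)_n (1 - q^(2 n + 2))\<close>, survives the limit.
\<close>

lemma theta_sum_tendsto:
  assumes "norm q < 1"
  shows "theta_sum q \<longlonglongrightarrow> qpoch_inf q q"
proof -
  let ?b = "\<lambda>r::nat. if r = 0 then qpoch_inf q q else 0"
  obtain K where K: "\<And>n r s m. r \<le> s \<Longrightarrow>
      norm (theta_coeff q n r * q ^ s * (1 - q ^ m)) \<le> K * norm q ^ r"
    using theta_series_bounded[OF assms] by blast
  have lim: "(\<lambda>n. theta_term q n r) \<longlonglongrightarrow> ?b r" for r
  proof -
    have qr: "(\<lambda>n. qpoch q q (r + n)) \<longlonglongrightarrow> qpoch_inf q q"
      using LIMSEQ_ignore_initial_segment[OF qpoch_tendsto[OF assms], of q r]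
      by (simp add: add.commute)
    have "(\<lambda>n. (- 1) ^ r * q ^ (5 * (r choose 2)) / qpoch q q r * q ^ (3 * r)
            * q ^ (n * (2 * r)) * qpoch q q (r + n) * (1 - q ^ (2 + 4 * r) * q ^ (n * 2)))
        \<longlonglongrightarrow> (- 1) ^ r * q ^ (5 * (r choose 2)) / qpoch q q r * q ^ (3 * r)
            * (if r = 0 then 1 else 0) * qpoch_inf q q * (1 - q ^ (2 + 4 * r) * 0)"
      using assms by (intro tendsto_mult tendsto_diff tendsto_const qr power_mult_tendsto_0)
        (auto intro: power_mult_tendsto_0)
    also have "(\<lambda>n. (- 1) ^ r * q ^ (5 * (r choose 2)) / qpoch q q r * q ^ (3 * r)
            * q ^ (n * (2 * r)) * qpoch q q (r + n) * (1 - q ^ (2 + 4 * r) * q ^ (n * 2)))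
        = (\<lambda>n. theta_term q n r)"
      by (simp add: theta_term_def theta_coeff_def power_add fun_eq_iff mult_ac)
    finally show ?thesis by (cases "r = 0") (simp_all add: numeral_2_eq_2)
  qed
  have "summable (\<lambda>k. K * norm q ^ k)"
    using assms by (intro summable_mult summable_geometric) auto
  moreover have "norm (theta_term q n r) \<le> K * norm q ^ r" for n r
    unfolding theta_term_def by (rule K) simp
  ultimately have "(\<lambda>n. \<Sum>r. theta_term q n r) \<longlonglongrightarrow> suminf ?b"
    using lim tannerys_theorem[where a = "\<lambda>r n. theta_term q n r" and b = ?b
        and M = "\<lambda>k. K * norm q ^ k" and F = sequentially]
    by (auto intro: always_eventually)
  then show ?thesis
    by (simp add: theta_sum_def[abs_def] sums_unique[OF sums_single, symmetric])
qed

lemma rr_sum_eq_theta_sum: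
  assumes "norm q < 1"
  shows "qpoch_inf q q * rr_sum q n = theta_sum q n"
proof -
  have "qpoch_inf q q * rr_sum q n - theta_sum q n = 0"
  proof (rule null_sequence_of_recurrence_eq_0[OF assms])
    fix n
    show "qpoch_inf q q * rr_sum q n - theta_sum q n
        = qpoch_inf q q * rr_sum q (Suc n) - theta_sum q (Suc n)
          + q ^ Suc n * (qpoch_inf q q * rr_sum q (Suc (Suc n)) - theta_sum q (Suc (Suc n)))"
      using rr_sum_rec[OF assms, of n] theta_sum_rec[OF assms, of n] by (simp add: algebra_simps)
    have "(\<lambda>n. qpoch_inf q q * rr_sum q n - theta_sum q n) \<longlonglongrightarrow> qpoch_inf q q * 1 - qpoch_inf q q"
      by (intro tendsto_intros rr_sum_tendsto theta_sum_tendsto assms)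
    then show "(\<lambda>n. qpoch_inf q q * rr_sum q n - theta_sum q n) \<longlonglongrightarrow> 0" by simp
  qed
  then show ?thesis by simp
qed

section \<open>The Rogers-Ramanujan identities\<close>

text \<open>
  At \<open>n = 0\<close> the Pochhammer symbols cancel, and the series is Jacobi's with base \<open>q^5\<close>,
  \<open>z = q^3\<close> and \<open>y = q^2\<close>.
\<close>

lemma theta_sum_0:
  assumes "norm q < 1" "q \<noteq> 0"
  shows "theta_sum q 0 = qpoch_inf_list [q ^ 2, q ^ 3, q ^ 5] (q ^ 5)"
proof -
  have "(\<lambda>r. (- (q ^ 3)) ^ r * (q ^ 5) ^ (r choose 2) + (- (q\<^sup>2)) ^ Suc r * (q ^ 5) ^ (Suc r choose 2))
      sums (qpoch_inf (q ^ 3) (q ^ 5) * qpoch_inf (q\<^sup>2) (q ^ 5) * qpoch_inf (q ^ 5) (q ^ 5))"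
    using assms norm_power_less_one[OF assms(1), of 5]
    by (intro jacobi_triple_product) (auto simp flip: power_add)
  also have "(\<lambda>r. (- (q ^ 3)) ^ r * (q ^ 5) ^ (r choose 2)
        + (- (q\<^sup>2)) ^ Suc r * (q ^ 5) ^ (Suc r choose 2)) = theta_term q 0"
  proof
    fix r
    have "q ^ (3 * r + 5 * (r choose 2)) * q ^ (4 * r + 2)
        = q ^ (2 * Suc r) * q ^ (5 * (Suc r choose 2))"
      unfolding power_add[symmetric] Suc_choose_two by simp
    then have "(- 1) ^ r * q ^ (3 * r + 5 * (r choose 2)) * (1 - q ^ (4 * r + 2))
        = (- 1) ^ r * q ^ (3 * r + 5 * (r choose 2))
          + (- 1) ^ Suc r * (q ^ (2 * Suc r) * q ^ (5 * (Suc r choose 2)))"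
      by (simp add: right_diff_distrib)
    then show "(- (q ^ 3)) ^ r * (q ^ 5) ^ (r choose 2)
        + (- (q\<^sup>2)) ^ Suc r * (q ^ 5) ^ (Suc r choose 2) = theta_term q 0 r"
      unfolding power_minus[of "q ^ 3"] power_minus[of "q\<^sup>2"] power_mult[symmetric]
      using qpoch_self_nonzero[OF assms(1), of r]
      by (simp add: theta_term_def theta_coeff_def power_add mult_ac del: power_Suc)
  qed
  finally show ?thesis
    by (simp add: theta_sum_def qpoch_inf_list_def sums_unique[symmetric] mult_ac)
qed

text \<open>
  Here \<open>theta_term1\<close> at \<open>n = 0\<close> gives Jacobi's series with base \<open>q^5\<close>, \<open>z = q^4\<close> and \<open>y = q\<close>.
\<close>

lemma theta_sum_1:
  assumes "norm q < 1" "q \<noteq> 0"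
  shows "theta_sum q 1 = qpoch_inf_list [q, q ^ 4, q ^ 5] (q ^ 5)"
proof -
  have "(\<lambda>r. (- (q ^ 4)) ^ r * (q ^ 5) ^ (r choose 2) + (- q) ^ Suc r * (q ^ 5) ^ (Suc r choose 2))
      sums (qpoch_inf (q ^ 4) (q ^ 5) * qpoch_inf q (q ^ 5) * qpoch_inf (q ^ 5) (q ^ 5))"
    using assms norm_power_less_one[OF assms(1), of 5]
    by (intro jacobi_triple_product) (auto simp flip: power_Suc2)
  also have "(\<lambda>r. (- (q ^ 4)) ^ r * (q ^ 5) ^ (r choose 2)
        + (- q) ^ Suc r * (q ^ 5) ^ (Suc r choose 2)) = theta_term1 q 0"
  proof
    fix r
    have "q ^ (4 * r + 5 * (r choose 2)) * q ^ (2 * r + 1)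
        = q ^ (Suc r + 5 * (Suc r choose 2))"
      unfolding power_add[symmetric] Suc_choose_two by simp
    then have "(- 1) ^ r * q ^ (4 * r + 5 * (r choose 2)) * (1 - q ^ (2 * r + 1))
        = (- 1) ^ r * q ^ (4 * r + 5 * (r choose 2))
          + (- 1) ^ Suc r * q ^ (Suc r + 5 * (Suc r choose 2))"
      by (simp add: right_diff_distrib)
    then show "(- (q ^ 4)) ^ r * (q ^ 5) ^ (r choose 2)
        + (- q) ^ Suc r * (q ^ 5) ^ (Suc r choose 2) = theta_term1 q 0 r"
      unfolding power_minus[of "q ^ 4"] power_minus[of q] power_mult[symmetric]
      using qpoch_self_nonzero[OF assms(1), of r]
      by (simp add: theta_term1_def theta_coeff_def power_add mult_ac)
  qed
  finally show ?thesis
    using theta_sum_Suc[OF assms(1), of 0]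
    by (simp add: qpoch_inf_list_def sums_unique[symmetric] mult_ac)
qed

text \<open>
  The triple product divides by powers of \<open>q\<close>, so \<open>q = 0\<close> is treated separately.
\<close>

lemma rr_sum_zero: "rr_sum 0 n = 1"
proof -
  have "rr_term 0 n = (\<lambda>k. if k = 0 then 1 else 0)"
    by (auto simp: rr_term_def)
  then show ?thesis
    by (simp add: rr_sum_def sums_unique[OF sums_single, symmetric])
qed

theorem rogers_ramanujan:
  assumes "norm q < 1"
  shows "rr_sum q 0 = qpoch_inf_list [q ^ 2, q ^ 3, q ^ 5] (q ^ 5) / qpoch_inf q q"
    and "rr_sum q 1 = qpoch_inf_list [q, q ^ 4, q ^ 5] (q ^ 5) / qpoch_inf q q"
proof -
  have *: "rr_sum q n = theta_sum q n / qpoch_inf q q" for n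
    using rr_sum_eq_theta_sum[OF assms, of n] qpoch_inf_self_nonzero[OF assms]
    by (simp add: field_simps)
  show "rr_sum q 0 = qpoch_inf_list [q ^ 2, q ^ 3, q ^ 5] (q ^ 5) / qpoch_inf q q"
    using theta_sum_0[OF assms] *[of 0]
    by (cases "q = 0") (simp_all add: rr_sum_zero qpoch_inf_list_def qpoch_inf_def)
  show "rr_sum q 1 = qpoch_inf_list [q, q ^ 4, q ^ 5] (q ^ 5) / qpoch_inf q q"
    using theta_sum_1[OF assms] *[of 1]
    by (cases "q = 0") (simp_all add: rr_sum_zero qpoch_inf_list_def qpoch_inf_def)
qed

section \<open>Reduction of the triple sum\<close>

lemma has_sum_iterated_sums:
  fixes f :: "'a \<Rightarrow> nat \<Rightarrow> complex"
  assumes "((\<lambda>(x, i). f x i) has_sum S) UNIV" "\<And>x. f x sums g x"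
  shows "(g has_sum S) UNIV"
proof (rule has_sum_SigmaD[where f = "\<lambda>(x, i). f x i" and B = "\<lambda>_. UNIV"])
  show "((\<lambda>(x, i). f x i) has_sum S) (UNIV \<times> UNIV)"
    using assms(1) by simp
  then have "f x summable_on UNIV" for x
    by (intro summable_on_SigmaD1[of f UNIV "\<lambda>_. UNIV"]) (auto dest: has_sum_imp_summable)
  then have "(f x has_sum g x) UNIV" for x
    using assms(2) by (metis has_sum_infsum has_sum_imp_sums sums_unique2)
  then show "((\<lambda>i. case (x, i) of (x, i) \<Rightarrow> f x i) has_sum g x) UNIV" for x
    by simp
qed

lemma summable_on_geometric_triple:
  fixes r :: real
  assumes "0 \<le> r" "r < 1"
  shows "(\<lambda>(i, j, k). r ^ i * (r ^ j * r ^ k)) summable_on (UNIV :: (nat \<times> nat \<times> nat) set)"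
proof -
  obtain s where geo: "((\<lambda>i. r ^ i) has_sum s) UNIV"
    using sums_nonneg_imp_has_sum[OF geometric_sums[of r]] assms by auto
  then have "(\<lambda>i. r ^ i) summable_on UNIV"
    by (rule has_sum_imp_summable)
  then have pair: "(\<lambda>(j, k). r ^ j * r ^ k) summable_on (UNIV \<times> UNIV)"
    by (intro summable_on_SigmaI[where g = "\<lambda>j. r ^ j * s"] summable_on_cmult_left)
      (use assms has_sum_cmult_right[OF geo] in auto)
  define t where "t = (\<Sum>\<^sub>\<infinity>(j, k)\<in>UNIV \<times> UNIV. r ^ j * r ^ k)"
  have t: "((\<lambda>(j, k). r ^ j * r ^ k) has_sum t) (UNIV \<times> UNIV)"
    unfolding t_def using pair by (rule has_sum_infsum)
  have "(\<lambda>(i, x). r ^ i * (case x of (j, k) \<Rightarrow> r ^ j * r ^ k)) summable_on (UNIV \<times> (UNIV \<times> UNIV))"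
    using \<open>(\<lambda>i. r ^ i) summable_on UNIV\<close>
    by (intro summable_on_SigmaI[where g = "\<lambda>i. r ^ i * t"] summable_on_cmult_left)
      (use assms has_sum_cmult_right[OF t] in auto)
  then show ?thesis by (simp add: case_prod_unfold)
qed

text \<open>
  Multiply numerator and denominator by \<open>(-q;q)_j\<close>: the numerator is completed to \<open>(-q;q)_\<infinity>\<close>
  and the denominator becomes \<open>(q^2;q^2)_j\<close>.  It is used in base \<open>q\<close> for \<open>j\<close> and in base \<open>q^2\<close>
  for \<open>k\<close>.
\<close>

lemma qpoch_inf_neg_divide_qpoch:
  assumes "norm q < 1"
  shows "qpoch_inf (- (q ^ Suc j)) q / qpoch q q j = qpoch_inf (- q) q / qpoch (q\<^sup>2) (q\<^sup>2) j"
proof -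
  have "qpoch q q j * qpoch (- q) q j = qpoch (q\<^sup>2) (q\<^sup>2) j"
    by (rule qpoch_mult_qpoch_minus)
  moreover from this have "qpoch (- q) q j \<noteq> 0"
    using norm_power_less_one[OF assms, of 2] qpoch_self_nonzero[of "q\<^sup>2" j] by auto
  moreover have "qpoch_inf (- q) q = qpoch (- q) q j * qpoch_inf (- (q ^ Suc j)) q"
    using qpoch_inf_split[OF assms, of "- q" j] by simp
  ultimately show ?thesis
    by (simp del: power_Suc flip: \<open>qpoch q q j * qpoch (- q) q j = _\<close>)
qed

lemma qpoch_inf_neg_mult:
  assumes "norm q < 1"
  shows "qpoch_inf (- q) q * qpoch_inf (- (q\<^sup>2)) (q\<^sup>2) = qpoch_inf (q ^ 4) (q ^ 4) / qpoch_inf q q"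
proof -
  have q2: "norm (q\<^sup>2) < 1" using norm_power_less_one[OF assms, of 2] by simp
  have "qpoch_inf q q * qpoch_inf (- q) q = qpoch_inf (q\<^sup>2) (q\<^sup>2)"
    by (rule qpoch_inf_mult_qpoch_inf_minus[OF assms])
  moreover have "qpoch_inf (q\<^sup>2) (q\<^sup>2) * qpoch_inf (- (q\<^sup>2)) (q\<^sup>2) = qpoch_inf (q ^ 4) (q ^ 4)"
    using qpoch_inf_mult_qpoch_inf_minus[OF q2, of "q\<^sup>2"] by (simp flip: power_mult)
  ultimately show ?thesis
    using qpoch_inf_self_nonzero[OF assms] by (metis mult.assoc nonzero_mult_div_cancel_left)
qed

text \<open>
  The parameter \<open>c\<close> covers both identities: \<open>c = 0\<close> for the first and \<open>c = 1\<close> for the second.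
\<close>

definition triple_term :: "complex \<Rightarrow> nat \<Rightarrow> nat \<Rightarrow> nat \<Rightarrow> nat \<Rightarrow> complex" where
  "triple_term q c i j k =
    q ^ ((i\<^sup>2 + i) div 2 + j\<^sup>2 + 4 * k\<^sup>2 + i * j + 2 * j * k + j + 4 * c * k)
      / (qpoch q q i * qpoch q q j * qpoch (q\<^sup>2) (q\<^sup>2) k)"

lemma triangular_eq_choose_two: "(i\<^sup>2 + i) div 2 = (i choose 2) + i"
  using twice_choose_two[of i] by simp

lemma summable_triple_term:
  assumes "norm q < 1"
  shows "(\<lambda>(i, j, k). triple_term q c i j k) summable_on UNIV"
proof -
  obtain K where K: "K > 0" "\<And>n. norm (inverse (qpoch q q n)) \<le> K"
    using inverse_qpoch_self_bounded[OF assms] by blast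
  obtain L where L: "L > 0" "\<And>n. norm (inverse (qpoch (q\<^sup>2) (q\<^sup>2) n)) \<le> L"
    using inverse_qpoch_self_bounded[of "q\<^sup>2"] norm_power_less_one[OF assms, of 2] by auto
  have bound: "norm (triple_term q c i j k)
      \<le> K * K * L * (norm q ^ i * (norm q ^ j * norm q ^ k))" for i j k
  proof -
    have "k \<le> k\<^sup>2" by (simp add: power2_nat_le_imp_le power2_eq_square)
    then have "i + j + k \<le> (i\<^sup>2 + i) div 2 + j\<^sup>2 + 4 * k\<^sup>2 + i * j + 2 * j * k + j + 4 * c * k"
      unfolding triangular_eq_choose_two by simp
    then have "norm q ^ ((i\<^sup>2 + i) div 2 + j\<^sup>2 + 4 * k\<^sup>2 + i * j + 2 * j * k + j + 4 * c * k)
        \<le> norm q ^ (i + j + k)"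
      using assms by (intro power_decreasing) auto
    then have "norm (inverse (qpoch q q i)) * norm (inverse (qpoch q q j))
          * norm (inverse (qpoch (q\<^sup>2) (q\<^sup>2) k))
          * norm q ^ ((i\<^sup>2 + i) div 2 + j\<^sup>2 + 4 * k\<^sup>2 + i * j + 2 * j * k + j + 4 * c * k)
        \<le> K * K * L * norm q ^ (i + j + k)"
      using K L by (intro mult_mono mult_nonneg_nonneg) (auto intro: less_imp_le)
    then show ?thesis
      by (simp add: triple_term_def norm_divide norm_mult norm_power norm_inverse power_add field_simps)
  qed
  have "(\<lambda>x. norm (case x of (i, j, k) \<Rightarrow> triple_term q c i j k)) summable_on UNIV"
  proof (rule Infinite_Sum.abs_summable_on_comparison_test')
    show "(\<lambda>x. K * K * L * (case x of (i, j, k) \<Rightarrow> norm q ^ i * (norm q ^ j * norm q ^ k)))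
        summable_on UNIV"
      using assms by (intro summable_on_cmult_right summable_on_geometric_triple) auto
  qed (use bound in auto)
  then show ?thesis by (rule abs_summable_summable)
qed

text \<open>
  Euler's expansion at \<open>x = q^(j+1)\<close>, since \<open>i (i+1) / 2 + i j = (i choose 2) + (j+1) i\<close>.
\<close>

lemma triple_term_sums_i:
  assumes "norm q < 1"
  shows "(\<lambda>i. triple_term q c i j k) sums
    (qpoch_inf (- q) q * q ^ (j\<^sup>2 + 4 * k\<^sup>2 + 2 * j * k + j + 4 * c * k)
      / (qpoch (q\<^sup>2) (q\<^sup>2) j * qpoch (q\<^sup>2) (q\<^sup>2) k))"
proof -
  define A where "A = q ^ (j\<^sup>2 + 4 * k\<^sup>2 + 2 * j * k + j + 4 * c * k) / qpoch (q\<^sup>2) (q\<^sup>2) k"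
  have "(\<lambda>i. (q ^ Suc j) ^ i * q ^ (i choose 2) / qpoch q q i * (A / qpoch q q j))
      sums (qpoch_inf (- (q ^ Suc j)) q * (A / qpoch q q j))"
    by (intro sums_mult2 euler_sums assms)
  also have "qpoch_inf (- (q ^ Suc j)) q * (A / qpoch q q j)
      = qpoch_inf (- (q ^ Suc j)) q / qpoch q q j * A" by simp
  also have "\<dots> = qpoch_inf (- q) q / qpoch (q\<^sup>2) (q\<^sup>2) j * A"
    unfolding qpoch_inf_neg_divide_qpoch[OF assms] ..
  also have "(\<lambda>i. (q ^ Suc j) ^ i * q ^ (i choose 2) / qpoch q q i * (A / qpoch q q j))
      = (\<lambda>i. triple_term q c i j k)"
  proof
    fix i
    have "(i\<^sup>2 + i) div 2 + j\<^sup>2 + 4 * k\<^sup>2 + i * j + 2 * j * k + j + 4 * c * k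
        = Suc j * i + (i choose 2) + (j\<^sup>2 + 4 * k\<^sup>2 + 2 * j * k + j + 4 * c * k)"
      unfolding triangular_eq_choose_two by simp
    then show "(q ^ Suc j) ^ i * q ^ (i choose 2) / qpoch q q i * (A / qpoch q q j)
        = triple_term q c i j k"
      unfolding triple_term_def A_def power_mult[symmetric] by (simp only: power_add) simp
  qed
  finally show ?thesis by (simp add: A_def)
qed

text \<open>
  Euler's expansion in base \<open>q^2\<close> at \<open>x = (q^2)^(k+1)\<close>, since
  \<open>j^2 + j + 2 j k = 2 (j choose 2) + 2 (k+1) j\<close>.
\<close>

lemma triple_term_sums_j:
  assumes "norm q < 1"
  shows "(\<lambda>j. qpoch_inf (- q) q * q ^ (j\<^sup>2 + 4 * k\<^sup>2 + 2 * j * k + j + 4 * c * k)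
      / (qpoch (q\<^sup>2) (q\<^sup>2) j * qpoch (q\<^sup>2) (q\<^sup>2) k)) sums
    (qpoch_inf (q ^ 4) (q ^ 4) / qpoch_inf q q * rr_term (q ^ 4) c k)"
proof -
  define A where "A = qpoch_inf (- q) q * q ^ (4 * k\<^sup>2 + 4 * c * k)"
  have q2: "norm (q\<^sup>2) < 1" using norm_power_less_one[OF assms, of 2] by simp
  have "(\<lambda>j. ((q\<^sup>2) ^ Suc k) ^ j * (q\<^sup>2) ^ (j choose 2) / qpoch (q\<^sup>2) (q\<^sup>2) j
          * (A / qpoch (q\<^sup>2) (q\<^sup>2) k))
      sums (qpoch_inf (- ((q\<^sup>2) ^ Suc k)) (q\<^sup>2) * (A / qpoch (q\<^sup>2) (q\<^sup>2) k))"
    by (intro sums_mult2 euler_sums q2)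
  also have "qpoch_inf (- ((q\<^sup>2) ^ Suc k)) (q\<^sup>2) * (A / qpoch (q\<^sup>2) (q\<^sup>2) k)
      = A * (qpoch_inf (- ((q\<^sup>2) ^ Suc k)) (q\<^sup>2) / qpoch (q\<^sup>2) (q\<^sup>2) k)" by simp
  also have "\<dots> = A * (qpoch_inf (- (q\<^sup>2)) (q\<^sup>2) / qpoch (q ^ 4) (q ^ 4) k)"
    unfolding qpoch_inf_neg_divide_qpoch[OF q2] by (simp flip: power_mult)
  also have "\<dots> = qpoch_inf (- q) q * qpoch_inf (- (q\<^sup>2)) (q\<^sup>2) * rr_term (q ^ 4) c k"
  proof -
    have "q ^ (4 * k\<^sup>2 + 4 * c * k) = (q ^ 4) ^ (k\<^sup>2 + c * k)"
      unfolding power_mult[symmetric] by (simp add: algebra_simps)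
    then show ?thesis by (simp add: A_def rr_term_def)
  qed
  also have "\<dots> = qpoch_inf (q ^ 4) (q ^ 4) / qpoch_inf q q * rr_term (q ^ 4) c k"
    unfolding qpoch_inf_neg_mult[OF assms] ..
  also have "(\<lambda>j. ((q\<^sup>2) ^ Suc k) ^ j * (q\<^sup>2) ^ (j choose 2) / qpoch (q\<^sup>2) (q\<^sup>2) j
          * (A / qpoch (q\<^sup>2) (q\<^sup>2) k))
      = (\<lambda>j. qpoch_inf (- q) q * q ^ (j\<^sup>2 + 4 * k\<^sup>2 + 2 * j * k + j + 4 * c * k)
          / (qpoch (q\<^sup>2) (q\<^sup>2) j * qpoch (q\<^sup>2) (q\<^sup>2) k))"
  proof
    fix j
    have "j\<^sup>2 + 4 * k\<^sup>2 + 2 * j * k + j + 4 * c * k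
        = 2 * (Suc k * j) + 2 * (j choose 2) + (4 * k\<^sup>2 + 4 * c * k)"
      unfolding twice_choose_two[of j, symmetric] by simp
    then show "((q\<^sup>2) ^ Suc k) ^ j * (q\<^sup>2) ^ (j choose 2) / qpoch (q\<^sup>2) (q\<^sup>2) j
          * (A / qpoch (q\<^sup>2) (q\<^sup>2) k)
        = qpoch_inf (- q) q * q ^ (j\<^sup>2 + 4 * k\<^sup>2 + 2 * j * k + j + 4 * c * k)
          / (qpoch (q\<^sup>2) (q\<^sup>2) j * qpoch (q\<^sup>2) (q\<^sup>2) k)"
      unfolding A_def power_mult[symmetric] by (simp only: power_add mult.assoc) simp
  qed
  finally show ?thesis .
qed

lemma triple_sum_eq_rr_sum:
  assumes "norm q < 1"
  shows "((\<lambda>(i, j, k). triple_term q c i j k) has_sum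
    (qpoch_inf (q ^ 4) (q ^ 4) / qpoch_inf q q * rr_sum (q ^ 4) c)) UNIV"
proof -
  obtain S where S: "((\<lambda>(i, j, k). triple_term q c i j k) has_sum S) UNIV"
    using summable_triple_term[OF assms] by (auto simp: summable_on_def)
  \<comment> \<open>regroup as \<open>((k, j), i)\<close>, so that \<open>i\<close> is summed first, then \<open>j\<close>, then \<open>k\<close>\<close>
  also have "?this \<longleftrightarrow> ((\<lambda>(x, i). triple_term q c i (snd x) (fst x)) has_sum S) UNIV"
    by (rule has_sum_reindex_bij_witness[of _ "\<lambda>((k, j), i). (i, j, k)" "\<lambda>(i, j, k). ((k, j), i)"])
      auto
  finally have "((\<lambda>x. qpoch_inf (- q) q
        * q ^ ((snd x)\<^sup>2 + 4 * (fst x)\<^sup>2 + 2 * snd x * fst x + snd x + 4 * c * fst x)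
        / (qpoch (q\<^sup>2) (q\<^sup>2) (snd x) * qpoch (q\<^sup>2) (q\<^sup>2) (fst x))) has_sum S) UNIV"
    by (rule has_sum_iterated_sums) (rule triple_term_sums_i[OF assms])
  then have "((\<lambda>(k, j). qpoch_inf (- q) q * q ^ (j\<^sup>2 + 4 * k\<^sup>2 + 2 * j * k + j + 4 * c * k)
        / (qpoch (q\<^sup>2) (q\<^sup>2) j * qpoch (q\<^sup>2) (q\<^sup>2) k)) has_sum S) UNIV"
    by (simp add: case_prod_unfold)
  then have "((\<lambda>k. qpoch_inf (q ^ 4) (q ^ 4) / qpoch_inf q q * rr_term (q ^ 4) c k) has_sum S) UNIV"
    by (rule has_sum_iterated_sums) (rule triple_term_sums_j[OF assms])
  then have "(\<lambda>k. qpoch_inf (q ^ 4) (q ^ 4) / qpoch_inf q q * rr_term (q ^ 4) c k) sums S"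
    by (rule has_sum_imp_sums)
  moreover have "(\<lambda>k. qpoch_inf (q ^ 4) (q ^ 4) / qpoch_inf q q * rr_term (q ^ 4) c k)
      sums (qpoch_inf (q ^ 4) (q ^ 4) / qpoch_inf q q * rr_sum (q ^ 4) c)"
    unfolding rr_sum_def using norm_power_less_one[OF assms, of 4]
    by (intro sums_mult summable_sums summable_rr_term) simp
  ultimately show ?thesis
    using S sums_unique2 by blast
qed

theorem theorem3p1:
  fixes q :: complex
  assumes "norm q < 1"
  shows "((\<lambda>(i, j, k).
            q ^ ((i^2 + i) div 2 + j^2 + 4 * k^2 + i * j + 2 * j * k + j)
              / (qpoch q q i * qpoch q q j * qpoch (q^2) (q^2) k))
          has_sum
            (qpoch_inf_list [q^8, q^12, q^20] (q^20) / qpoch_inf q q))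
          (UNIV :: (nat \<times> nat \<times> nat) set)
       \<and> ((\<lambda>(i, j, k).
            q ^ ((i^2 + i) div 2 + j^2 + 4 * k^2 + i * j + 2 * j * k + j + 4 * k)
              / (qpoch q q i * qpoch q q j * qpoch (q^2) (q^2) k))
          has_sum
            (qpoch_inf_list [q^4, q^16, q^20] (q^20) / qpoch_inf q q))
          (UNIV :: (nat \<times> nat \<times> nat) set)"
proof -
  have q4: "norm (q ^ 4) < 1"
    using norm_power_less_one[OF assms, of 4] by simp
  have first: "qpoch_inf (q ^ 4) (q ^ 4) / qpoch_inf q q * rr_sum (q ^ 4) 0
      = qpoch_inf_list [q^8, q^12, q^20] (q^20) / qpoch_inf q q"
    unfolding rogers_ramanujan(1)[OF q4] using qpoch_inf_self_nonzero[OF q4]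
    by (simp flip: power_mult)
  have second: "qpoch_inf (q ^ 4) (q ^ 4) / qpoch_inf q q * rr_sum (q ^ 4) 1
      = qpoch_inf_list [q^4, q^16, q^20] (q^20) / qpoch_inf q q"
    unfolding rogers_ramanujan(2)[OF q4] using qpoch_inf_self_nonzero[OF q4]
    by (simp flip: power_mult)
  show ?thesis
    using triple_sum_eq_rr_sum[OF assms, of 0] triple_sum_eq_rr_sum[OF assms, of 1]
    unfolding first second by (simp add: triple_term_def)
qed

end
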